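(* For every integer $n\geq 2$ and every integer $k\geq 3$, the distinguishing index of the dutch windmill graph $D_n^k$ is $$D'(D_n^k)=\min\left\{r\in\mathbb{N}:~\frac{r^{k}-r^{\lceil k/2 \rceil}}{2}\geq n\right\}.$$
   Context: All graphs are simple. The dutch windmill graph $D_n^k$ ($n\geq 2$, $k\geq 3$) is the graph obtained by taking $n$ copies of the cycle $C_k$ and identifying one vertex from each copy into a single common (central) vertex. The distinguishing index $D'(G)$ of a graph $G$ is the least number $d$ such that there is a labeling of the edges of $G$ with $d$ labels that is preserved only by the identity automorphism of $G$. *)

theory Defs
  imports Complex_Main
begin

record 'a ugraph =
  verts :: "'a set"
  edges :: "'a set set"

definition simple_graph :: "'a ugraph \<Rightarrow> bool" where
  "simple_graph G \<longleftrightarrow> (\<forall>e\<in>edges G. e \<subseteq> verts G \<and> card e = 2)"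

definition automorphism :: "'a ugraph \<Rightarrow> ('a \<Rightarrow> 'a) \<Rightarrow> bool" where
  "automorphism G f \<longleftrightarrow>
     bij_betw f (verts G) (verts G) \<and>
     (\<forall>u\<in>verts G. \<forall>v\<in>verts G. {f u, f v} \<in> edges G \<longleftrightarrow> {u, v} \<in> edges G)"

text \<open>The labels are the numbers below \<open>d\<close>; not all of them have to be used. Functions are total,
  so an automorphism counts as the identity if it fixes every vertex, whatever it does elsewhere.\<close>

definition distinguishing_labeling :: "'a ugraph \<Rightarrow> nat \<Rightarrow> ('a set \<Rightarrow> nat) \<Rightarrow> bool" where
  "distinguishing_labeling G d c \<longleftrightarrow>
     (\<forall>e\<in>edges G. c e < d) \<and>
     (\<forall>f. automorphism G f \<and> (\<forall>e\<in>edges G. c (f ` e) = c e) \<longrightarrow> (\<forall>v\<in>verts G. f v = v))"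

definition distinguishing_index :: "'a ugraph \<Rightarrow> nat" where
  "distinguishing_index G = (LEAST d. \<exists>c. distinguishing_labeling G d c)"

definition cycle_graph :: "nat \<Rightarrow> nat ugraph" where
  "cycle_graph k = \<lparr>verts = {..<k}, edges = {{i, Suc i mod k} | i. i < k}\<rparr>"

definition disjoint_copies :: "nat \<Rightarrow> 'a ugraph \<Rightarrow> (nat \<times> 'a) ugraph" where
  "disjoint_copies n G =
     \<lparr>verts = {..<n} \<times> verts G, edges = (\<Union>i<n. (\<lambda>e. Pair i ` e) ` edges G)\<rparr>"

definition image_graph :: "('a \<Rightarrow> 'b) \<Rightarrow> 'a ugraph \<Rightarrow> 'b ugraph" where
  "image_graph q G = \<lparr>verts = q ` verts G, edges = (\<lambda>e. q ` e) ` edges G\<rparr>"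

text \<open>Vertex \<open>0\<close> of each copy is the one that is identified; \<open>(0, 0)\<close> represents the resulting
  central vertex.\<close>

definition merge_centre :: "nat \<times> nat \<Rightarrow> nat \<times> nat" where
  "merge_centre p = (if snd p = 0 then (0, 0) else p)"

definition dutch_windmill :: "nat \<Rightarrow> nat \<Rightarrow> (nat \<times> nat) ugraph" where
  "dutch_windmill n k = image_graph merge_centre (disjoint_copies n (cycle_graph k))"

lemma simple_graph_dutch_windmill:
  assumes "k \<ge> 3"
  shows "simple_graph (dutch_windmill n k)"
proof -
  have "merge_centre (i, j) \<noteq> merge_centre (i, Suc j mod k)" if "j < k" for i j
    using that assms by (cases "Suc j = k") (auto simp: merge_centre_def)
  then show ?thesis
    using assms
    by (auto simp: simple_graph_def dutch_windmill_def image_graph_def disjoint_copies_def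
        cycle_graph_def card_insert_if)
qed

end

theory Submission
  imports Defs "HOL-Library.List_Lexorder"
begin

text \<open>Reading the labels around a petal gives a word of length \<open>k\<close>. An automorphism fixes the centre,
  the only vertex with more than two neighbours, so it permutes the petals and possibly reverses
  some of them. Hence a labeling is distinguishing iff no word is a palindrome and the words of
  distinct petals are different even up to reversal. There are \<open>(r\<^sup>k - r\<^bsup>\<lceil>k/2\<rceil>\<^esup>) / 2\<close> classes of
  non-palindromic words over \<open>r\<close> letters up to reversal.\<close>

section \<open>Words up to reversal\<close>

text \<open>A palindrome is determined by its first half, including the middle letter when
  \<open>k\<close> is odd, and that half can be prescribed freely.\<close>

lemma card_palindromes:
  assumes "finite A"
  shows "card {w. set w \<subseteq> A \<and> length w = k \<and> rev w = w} = card A ^ ((k + 1) div 2)"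
proof -
  let ?m = "(k + 1) div 2"
  \<comment> \<open>Only \<open>k div 2\<close> letters are mirrored, so a middle letter is not
    doubled.\<close>
  let ?ext = "\<lambda>u. u @ rev (take (k div 2) u)"
  have "bij_betw (take ?m) {w. set w \<subseteq> A \<and> length w = k \<and> rev w = w}
      {u. set u \<subseteq> A \<and> length u = ?m}"
  proof (rule bij_betw_byWitness[where f' = ?ext])
    show "\<forall>w\<in>{w. set w \<subseteq> A \<and> length w = k \<and> rev w = w}. ?ext (take ?m w) = w"
    proof
      fix w :: "'a list"
      assume "w \<in> {w. set w \<subseteq> A \<and> length w = k \<and> rev w = w}"
      then have w: "length w = k" "rev w = w" by auto
      have "k - k div 2 = ?m" "min (k div 2) ?m = k div 2"
        by linarith+
      then have "rev (take (k div 2) (take ?m w)) = drop ?m w"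
        using w by (simp add: rev_take)
      then show "?ext (take ?m w) = w"
        by simp
    qed
    show "\<forall>u\<in>{u. set u \<subseteq> A \<and> length u = ?m}. take ?m (?ext u) = u"
      by simp
    show "take ?m ` {w. set w \<subseteq> A \<and> length w = k \<and> rev w = w} \<subseteq> {u. set u \<subseteq> A \<and> length u = ?m}"
      by (auto dest: in_set_takeD)
    show "?ext ` {u. set u \<subseteq> A \<and> length u = ?m} \<subseteq> {w. set w \<subseteq> A \<and> length w = k \<and> rev w = w}"
    proof (rule image_subsetI)
      fix u :: "'a list"
      assume "u \<in> {u. set u \<subseteq> A \<and> length u = ?m}"
      then have u: "set u \<subseteq> A" "length u = ?m" by auto
      \<comment> \<open>The left side is \<open>rev (?ext u)\<close>: this is the palindrome
        property.\<close>
      have "take (k div 2) u @ rev u = u @ rev (take (k div 2) u)"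
      proof (rule nth_equalityI)
        fix i
        assume i: "i < length (take (k div 2) u @ rev u)"
        have m: "?m = k div 2 \<or> ?m = Suc (k div 2)" by linarith
        \<comment> \<open>The second case occurs only for odd \<open>k\<close>, with
          \<open>i\<close> the middle position.\<close>
        consider "i < k div 2" | "k div 2 \<le> i" "i < ?m" | "?m \<le> i" by linarith
        then show "(take (k div 2) u @ rev u) ! i = (u @ rev (take (k div 2) u)) ! i"
        proof cases
          case 1
          then show ?thesis using u m by (auto simp: nth_append)
        next
          case 2
          then have h: "i = k div 2" "?m = Suc i" using m by linarith+
          then have "rev u ! 0 = u ! i" using u(2) by (subst rev_nth) auto
          then show ?thesis using u(2) h by (simp add: nth_append)
        next
          case 3
          then show ?thesis using u m i by (auto simp: nth_append rev_nth)
        qed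
      qed (use u in simp)
      moreover have "length (?ext u) = k"
        using u(2) by simp
      moreover have "set (?ext u) \<subseteq> A"
        using u(1) set_take_subset[of "k div 2" u] by auto
      ultimately show "?ext u \<in> {w. set w \<subseteq> A \<and> length w = k \<and> rev w = w}"
        by simp
    qed
  qed
  then show ?thesis
    by (simp add: bij_betw_same_card card_lists_length_eq[OF assms])
qed

text \<open>The lexicographic order picks one representative from each two-element class
  \<open>{w, rev w}\<close>; palindromes drop out because the inequality is strict.\<close>

definition rev_minimal_words :: "'a::linorder set \<Rightarrow> nat \<Rightarrow> 'a list set" where
  "rev_minimal_words A k = {w. set w \<subseteq> A \<and> length w = k \<and> w < rev w}"

lemma finite_rev_minimal_words: "finite A \<Longrightarrow> finite (rev_minimal_words A k)"
  by (rule finite_subset[OF _ finite_lists_length_eq[of A k]]) (auto simp: rev_minimal_words_def)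

text \<open>All words split into the minimal ones, their equally many reversals, and the
  palindromes. The additive form avoids truncated subtraction and division on
  \<open>nat\<close>.\<close>

lemma card_rev_minimal_words:
  assumes "finite A"
  shows "2 * card (rev_minimal_words A k) + card A ^ ((k + 1) div 2) = card A ^ k"
proof -
  let ?M = "rev_minimal_words A k"
  let ?P = "{w. set w \<subseteq> A \<and> length w = k \<and> rev w = w}"
  have M: "w < rev w" if "w \<in> ?M" for w
    using that by (simp add: rev_minimal_words_def)
  have M': "rev w < w" if "w \<in> rev ` ?M" for w
    using that M by auto
  have "{w. set w \<subseteq> A \<and> length w = k} = (?M \<union> rev ` ?M) \<union> ?P"
  proof (intro equalityI subsetI)
    fix w
    assume w: "w \<in> {w. set w \<subseteq> A \<and> length w = k}"
    consider "w < rev w" | "rev w < rev (rev w)" | "rev w = w"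
      using less_linear[of w "rev w"] by auto
    then show "w \<in> (?M \<union> rev ` ?M) \<union> ?P"
    proof cases
      case 2
      then have "rev w \<in> ?M" using w by (simp add: rev_minimal_words_def)
      then have "w \<in> rev ` ?M" by (intro image_eqI[of w rev "rev w"]) simp
      then show ?thesis by blast
    qed (use w in \<open>simp_all add: rev_minimal_words_def\<close>)
  qed (auto simp: rev_minimal_words_def)
  moreover have "finite ?P"
    by (rule finite_subset[OF _ finite_lists_length_eq[OF assms, of k]]) auto
  moreover have "?M \<inter> rev ` ?M = {}" "(?M \<union> rev ` ?M) \<inter> ?P = {}"
    using M M' by force+
  moreover have "card (rev ` ?M) = card ?M"
    by (simp add: card_image)
  ultimately show ?thesis
    using card_lists_length_eq[OF assms, of k] card_palindromes[OF assms, of k]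
      finite_rev_minimal_words[OF assms, of k]
    by (simp add: card_Un_disjoint)
qed

text \<open>The flag \<open>s\<close> merges several conditions: \<open>i = j\<close> with
  \<open>s\<close> true excludes palindromes, and \<open>i \<noteq> j\<close> excludes equality up
  to reversal.\<close>

definition chiral_family :: "nat \<Rightarrow> (nat \<Rightarrow> 'a list) \<Rightarrow> bool" where
  "chiral_family n w \<longleftrightarrow>
     (\<forall>i<n. \<forall>j<n. \<forall>s. w i = (if s then rev (w j) else w j) \<longrightarrow> i = j \<and> \<not> s)"

lemma chiral_familyD:
  "chiral_family n w \<Longrightarrow> i < n \<Longrightarrow> j < n \<Longrightarrow> w i = (if s then rev (w j) else w j) \<Longrightarrow> i = j \<and> \<not> s"
  unfolding chiral_family_def by blast

text \<open>Such a family amounts to a choice of \<open>n\<close> different reversal classes of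
  non-palindromes, so only the number of classes matters.\<close>

lemma ex_chiral_family_iff:
  fixes A :: "'a::linorder set"
  assumes "finite A"
  shows "(\<exists>w. chiral_family n w \<and> (\<forall>i<n. set (w i) \<subseteq> A \<and> length (w i) = k)) \<longleftrightarrow>
    n \<le> card (rev_minimal_words A k)"
proof
  assume "\<exists>w. chiral_family n w \<and> (\<forall>i<n. set (w i) \<subseteq> A \<and> length (w i) = k)"
  then obtain w where w: "chiral_family n w" "\<forall>i<n. set (w i) \<subseteq> A \<and> length (w i) = k"
    by blast
  let ?h = "\<lambda>i. min (w i) (rev (w i))"
  have "inj_on ?h {..<n}"
  proof (rule inj_onI)
    fix i j
    assume ij: "i \<in> {..<n}" "j \<in> {..<n}" "?h i = ?h j"
    then have "w i = w j \<or> w i = rev (w j)"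
      by (metis min_def rev_rev_ident)
    then show "i = j"
      using chiral_familyD[OF w(1), of i j True] chiral_familyD[OF w(1), of i j False] ij by auto
  qed
  moreover have "?h ` {..<n} \<subseteq> rev_minimal_words A k"
  proof clarify
    fix i
    assume "i < n"
    moreover have "w i \<noteq> rev (w i)"
      using chiral_familyD[OF w(1), of i i True] \<open>i < n\<close> by auto
    ultimately show "?h i \<in> rev_minimal_words A k"
      using w(2) by (auto simp: rev_minimal_words_def min_def)
  qed
  ultimately show "n \<le> card (rev_minimal_words A k)"
    using card_inj_on_le[OF _ _ finite_rev_minimal_words[OF assms], of ?h "{..<n}" k] by simp
next
  assume "n \<le> card (rev_minimal_words A k)"
  then obtain w where w: "inj_on w {..<n}" "w ` {..<n} \<subseteq> rev_minimal_words A k"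
    using card_le_inj[of "{..<n}" "rev_minimal_words A k"] finite_rev_minimal_words[OF assms, of k]
    unfolding card_lessThan by blast
  have "i = j \<and> \<not> s" if "i < n" "j < n" "w i = (if s then rev (w j) else w j)" for i j s
  proof -
    have "w i < rev (w i)" "w j < rev (w j)"
      using w(2) that by (auto simp: rev_minimal_words_def)
    \<comment> \<open>Otherwise \<open>w i = rev (w j)\<close>, and the two inequalities would give
      both \<open>w i < w j\<close> and \<open>w j < w i\<close>.\<close>
    then have "\<not> s" using that(3) by auto
    then show ?thesis using that w(1) by (auto simp: inj_on_def)
  qed
  moreover have "\<forall>i<n. set (w i) \<subseteq> A \<and> length (w i) = k"
    using w(2) by (auto simp: rev_minimal_words_def)
  ultimately show "\<exists>w. chiral_family n w \<and> (\<forall>i<n. set (w i) \<subseteq> A \<and> length (w i) = k)"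
    unfolding chiral_family_def by blast
qed

section \<open>The windmill graph\<close>

text \<open>The closed walk around petal \<open>i\<close>: positions \<open>0\<close> and \<open>k\<close> are both the centre. The flag \<open>s\<close>
  selects the reversed direction.\<close>

definition petal :: "nat \<Rightarrow> bool \<Rightarrow> nat \<Rightarrow> nat \<Rightarrow> nat \<times> nat" where
  "petal k s i j = (if j = 0 \<or> j = k then (0, 0) else (i, if s then k - j else j))"

definition petal_edge :: "nat \<Rightarrow> bool \<Rightarrow> nat \<Rightarrow> nat \<Rightarrow> (nat \<times> nat) set" where
  "petal_edge k s i j = {petal k s i j, petal k s i (Suc j)}"

lemma petal_rev: "j \<le> k \<Longrightarrow> petal k True i j = petal k False i (k - j)"
  by (auto simp: petal_def)

lemma petal_edge_rev: "j < k \<Longrightarrow> petal_edge k True i j = petal_edge k False i (k - Suc j)"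
  by (auto simp: petal_edge_def petal_rev Suc_diff_Suc)

lemma petal_inj:
  "petal k s i j = petal k s i' j' \<Longrightarrow> 0 < j \<Longrightarrow> j < k \<Longrightarrow> j' \<le> k \<Longrightarrow> i = i' \<and> j = j'"
  by (auto simp: petal_def split: if_splits)

lemma petal_eq_centre_iff: "j \<le> k \<Longrightarrow> petal k s i j = (0, 0) \<longleftrightarrow> j = 0 \<or> j = k"
  by (auto simp: petal_def)

text \<open>Each edge has an interior endpoint, which identifies the petal. Matching endpoints
  crosswise would need a closed walk of length 2; for \<open>k = 2\<close> the two edges of a petal
  would indeed coincide.\<close>

lemma petal_edge_inj:
  assumes "petal_edge k False i j = petal_edge k False i' j'" "k \<ge> 3" "j < k" "j' < k"
  shows "i = i' \<and> j = j'"
proof -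
  consider "petal k False i j = petal k False i' j'"
      "petal k False i (Suc j) = petal k False i' (Suc j')"
    | "petal k False i j = petal k False i' (Suc j')" "petal k False i (Suc j) = petal k False i' j'"
    using assms(1) unfolding petal_edge_def doubleton_eq_iff by blast
  then show ?thesis
  proof cases
    case 1
    then show ?thesis
      using petal_inj[OF 1(1)] petal_inj[OF 1(2)] assms(2-) by (cases "j = 0") auto
  next
    case 2
    show ?thesis
    proof (cases "j = 0")
      case True
      then show ?thesis
        using petal_inj[OF 2(2)] petal_inj[OF 2(1)[symmetric]] assms(2-) by auto
    next
      case False
      then have "j = Suc j'" using petal_inj[OF 2(1)] assms(2-) by auto
      then show ?thesis
        using petal_inj[OF 2(2)[symmetric]] petal_inj[OF 2(2)] assms(2-) by (cases "j' = 0") auto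
    qed
  qed
qed

lemma verts_dutch_windmill:
  assumes "n \<ge> 1" "k \<ge> 1"
  shows "verts (dutch_windmill n k) = {petal k False i j | i j. i < n \<and> j \<le> k}"
proof -
  have "verts (dutch_windmill n k) = {merge_centre (i, j) | i j. i < n \<and> j < k}"
    by (auto simp: dutch_windmill_def image_graph_def disjoint_copies_def cycle_graph_def)
  also have "\<dots> = {petal k False i j | i j. i < n \<and> j \<le> k}"
  proof (intro equalityI subsetI)
    fix x
    assume "x \<in> {merge_centre (i, j) | i j. i < n \<and> j < k}"
    then obtain i j where "x = merge_centre (i, j)" "i < n" "j < k" by blast
    then have "x = petal k False i j \<and> i < n \<and> j \<le> k"
      by (auto simp: merge_centre_def petal_def)
    then show "x \<in> {petal k False i j | i j. i < n \<and> j \<le> k}" by blast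
  next
    fix x
    assume "x \<in> {petal k False i j | i j. i < n \<and> j \<le> k}"
    then obtain i j where "x = petal k False i j" "i < n" "j \<le> k" by blast
    \<comment> \<open>The reduction changes only \<open>j = k\<close>, the second name of the
      centre.\<close>
    then have "x = merge_centre (i, j mod k) \<and> i < n \<and> j mod k < k"
      using assms by (auto simp: merge_centre_def petal_def)
    then show "x \<in> {merge_centre (i, j) | i j. i < n \<and> j < k}" by blast
  qed
  finally show ?thesis .
qed

lemma edges_dutch_windmill:
  "edges (dutch_windmill n k) = {petal_edge k False i j | i j. i < n \<and> j < k}"
proof -
  have *: "petal_edge k False i j = {merge_centre (i, j), merge_centre (i, Suc j mod k)}"
    if "j < k" for i j
    using that by (cases "Suc j = k") (auto simp: petal_edge_def petal_def merge_centre_def)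
  have "{{j, Suc j mod k} | j. j < k} = (\<lambda>j. {j, Suc j mod k}) ` {..<k}"
    by auto
  then have "edges (dutch_windmill n k) =
      (\<Union>i<n. (\<lambda>j. {merge_centre (i, j), merge_centre (i, Suc j mod k)}) ` {..<k})"
    by (simp add: dutch_windmill_def image_graph_def disjoint_copies_def cycle_graph_def
        image_UN image_image)
  also have "\<dots> = (\<Union>i<n. petal_edge k False i ` {..<k})"
    using * by simp
  also have "\<dots> = {petal_edge k False i j | i j. i < n \<and> j < k}"
    by blast
  finally show ?thesis .
qed

lemma edges_dutch_windmillE:
  assumes "e \<in> edges (dutch_windmill n k)"
  obtains i j where "e = petal_edge k False i j" "i < n" "j < k"
  using assms unfolding edges_dutch_windmill by blast

lemma petal_in_verts:
  assumes "i < n" "j \<le> k" "k \<ge> 1"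
  shows "petal k s i j \<in> verts (dutch_windmill n k)"
proof -
  have "petal k s i j = petal k False i (if s then k - j else j) \<and> (if s then k - j else j) \<le> k"
    using assms by (simp add: petal_rev)
  moreover have "n \<ge> 1" using assms by simp
  ultimately show ?thesis
    using assms unfolding verts_dutch_windmill[OF \<open>n \<ge> 1\<close> assms(3)] by blast
qed

lemma petal_edge_in_edges:
  assumes "i < n" "j < k"
  shows "petal_edge k s i j \<in> edges (dutch_windmill n k)"
proof -
  let ?j = "if s then k - Suc j else j"
  have "petal_edge k s i j = petal_edge k False i ?j \<and> ?j < k"
    using assms by (simp add: petal_edge_rev)
  then show ?thesis
    using assms unfolding edges_dutch_windmill by blast
qed

text \<open>Interior vertices have degree two. The forward direction is read off the edge set; the
  reversed one follows by reflecting positions.\<close>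

lemma petal_neighbour:
  assumes "{petal k s i j, x} \<in> edges (dutch_windmill n k)" "0 < j" "j < k" "k \<ge> 3"
  shows "x = petal k s i (j - 1) \<or> x = petal k s i (Suc j)"
proof -
  have fwd: "y = petal k False i m \<or> y = petal k False i (Suc (Suc m))"
    if y: "{petal k False i (Suc m), y} \<in> edges (dutch_windmill n k)" "Suc m < k" for m y
  proof -
    obtain i' j' where e: "{petal k False i (Suc m), y} = petal_edge k False i' j'" "i' < n" "j' < k"
      using y(1) by (rule edges_dutch_windmillE)
    then consider "petal k False i (Suc m) = petal k False i' j'" "y = petal k False i' (Suc j')"
      | "petal k False i (Suc m) = petal k False i' (Suc j')" "y = petal k False i' j'"
      unfolding petal_edge_def doubleton_eq_iff by blast
    then show ?thesis
    proof cases
      case 1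
      then have "i = i' \<and> Suc m = j'"
        using petal_inj[OF 1(1)] y(2) e(3) by simp
      then show ?thesis using 1(2) by auto
    next
      case 2
      then have "i = i' \<and> Suc m = Suc j'"
        using petal_inj[OF 2(1)] y(2) e(3) by simp
      then show ?thesis using 2(2) by auto
    qed
  qed
  show ?thesis
  proof (cases s)
    case True
    \<comment> \<open>Position \<open>j\<close> of the reversed walk is position
      \<open>k - j\<close> of the forward one, written as a successor to fit
      \<open>fwd\<close>.\<close>
    have "{petal k False i (Suc (k - Suc j)), x} \<in> edges (dutch_windmill n k)"
      using assms True by (simp add: petal_rev Suc_diff_Suc)
    from fwd[OF this] have "x = petal k False i (k - Suc j) \<or> x = petal k False i (Suc (k - j))"
      using assms by (simp add: Suc_diff_Suc)
    moreover have "Suc (k - j) = k - (j - 1)" using assms by simp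
    ultimately show ?thesis
      using True assms petal_rev[of "j - 1" k i] petal_rev[of "Suc j" k i] by auto
  next
    case False
    then show ?thesis using fwd[of "j - 1" x] assms by auto
  qed
qed

text \<open>The last vertex of a forward walk counts as the first of the reversed walk, so position
  1 covers both ends of a petal.\<close>

lemma centre_neighbour:
  assumes "{(0, 0), x} \<in> edges (dutch_windmill n k)" "k \<ge> 3"
  shows "\<exists>i<n. \<exists>s. x = petal k s i 1"
proof -
  obtain i j where e: "{(0, 0), x} = petal_edge k False i j" "i < n" "j < k"
    using assms(1) by (rule edges_dutch_windmillE)
  then consider "petal k False i j = (0, 0)" "x = petal k False i (Suc j)"
    | "petal k False i (Suc j) = (0, 0)" "x = petal k False i j"
    unfolding petal_edge_def doubleton_eq_iff by metis
  then show ?thesis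
  proof cases
    case 1
    then have "x = petal k False i 1" using e(3) petal_eq_centre_iff[of j k False i] by simp
    then show ?thesis using e(2) by blast
  next
    case 2
    then have "Suc j = k" using e(3) petal_eq_centre_iff[of "Suc j" k False i] by simp
    then have "x = petal k True i 1" using 2(2) petal_rev[of 1 k i] assms by auto
    then show ?thesis using e(2) by blast
  qed
qed

section \<open>Automorphisms\<close>

text \<open>If the centre moved, its image would be an interior vertex with at most two neighbours,
  but the centre has at least three.\<close>

lemma automorphism_fixes_centre:
  assumes f: "automorphism (dutch_windmill n k) f" and n: "n \<ge> 2" and k: "k \<ge> 3"
  shows "f (0, 0) = (0, 0)"
proof (rule ccontr)
  assume nc: "f (0, 0) \<noteq> (0, 0)"
  let ?G = "dutch_windmill n k"
  have c: "(0, 0) \<in> verts ?G"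
    using petal_in_verts[of 0 n 0 k False] n k by (simp add: petal_def)
  then have "f (0, 0) \<in> verts ?G"
    using f by (auto simp: automorphism_def bij_betw_def)
  then obtain i j where ij: "f (0, 0) = petal k False i j" "j \<le> k"
    using n k by (auto simp: verts_dutch_windmill)
  then have j: "0 < j" "j < k"
    using nc petal_eq_centre_iff[of j k False i] by auto
  have adj: "f x = petal k False i (j - 1) \<or> f x = petal k False i (Suc j)"
    if "{(0, 0), x} \<in> edges ?G" "x \<in> verts ?G" for x
  proof (rule petal_neighbour[OF _ j k])
    show "{petal k False i j, f x} \<in> edges ?G"
      using f that c ij(1) unfolding automorphism_def by metis
  qed
  have nb: "{(0, 0), petal k s a 1} \<in> edges ?G \<and> petal k s a 1 \<in> verts ?G" if "a < n" for s a
    using petal_edge_in_edges[of a n 0 k s] petal_in_verts[of a n 1 k s] that k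
    by (simp add: petal_edge_def petal_def)
  \<comment> \<open>Petal 1 exists since \<open>n \<ge> 2\<close>, and the two ends of petal 0
    differ since \<open>k \<ge> 3\<close>. Two of the three images must coincide.\<close>
  let ?x = "petal k False 0 1" and ?y = "petal k True 0 1" and ?z = "petal k False 1 1"
  have "f ?x = f ?y \<or> f ?x = f ?z \<or> f ?y = f ?z"
    using adj[of ?x] adj[of ?y] adj[of ?z] nb[of 0 False] nb[of 0 True] nb[of 1 False] n by auto
  moreover have "inj_on f (verts ?G)"
    using f by (simp add: automorphism_def bij_betw_def)
  ultimately have "?x = ?y \<or> ?x = ?z \<or> ?y = ?z"
    using nb[of 0 False] nb[of 0 True] nb[of 1 False] n by (auto dest: inj_onD)
  then show False using k by (auto simp: petal_def)
qed

text \<open>The image of the first edge fixes the target petal and direction; from then on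
  injectivity forbids turning back, so the walk is forced.\<close>

lemma automorphism_maps_petal:
  assumes f: "automorphism (dutch_windmill n k) f" and n: "n \<ge> 2" and k: "k \<ge> 3" and i: "i < n"
  obtains i' s where "i' < n" "\<And>j. j \<le> k \<Longrightarrow> f (petal k False i j) = petal k s i' j"
proof -
  let ?G = "dutch_windmill n k" and ?p = "petal k False i"
  have centre: "f (0, 0) = (0, 0)"
    by (rule automorphism_fixes_centre[OF f n k])
  have V: "?p j \<in> verts ?G" if "j \<le> k" for j
    using petal_in_verts i k that by simp
  have E: "{f (?p j), f (?p (Suc j))} \<in> edges ?G" if "j < k" for j
  proof -
    have "{?p j, ?p (Suc j)} \<in> edges ?G"
      using petal_edge_in_edges[OF i that, of False] by (simp add: petal_edge_def)
    then show ?thesis using f V that unfolding automorphism_def by (metis Suc_leI less_imp_le)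
  qed
  have inj: "inj_on f (verts ?G)"
    using f by (simp add: automorphism_def bij_betw_def)
  have "{(0, 0), f (?p 1)} \<in> edges ?G"
    using E[of 0] k centre by (simp add: petal_def)
  then obtain i' s where i': "i' < n" "f (?p 1) = petal k s i' 1"
    using centre_neighbour k by blast
  \<comment> \<open>Two consecutive positions are carried along, since the next one is found by
    excluding the previous one.\<close>
  have step: "f (?p j) = petal k s i' j \<and> f (?p (Suc j)) = petal k s i' (Suc j)" if "j < k" for j
    using that
  proof (induction j)
    case 0
    then show ?case using i' centre by (simp add: petal_def)
  next
    case (Suc j)
    then have IH: "f (?p j) = petal k s i' j" "f (?p (Suc j)) = petal k s i' (Suc j)" by auto
    have "{petal k s i' (Suc j), f (?p (Suc (Suc j)))} \<in> edges ?G"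
      using E[OF Suc.prems] IH by simp
    from petal_neighbour[OF this] Suc.prems k
    have "f (?p (Suc (Suc j))) = petal k s i' j \<or> f (?p (Suc (Suc j))) = petal k s i' (Suc (Suc j))"
      by simp
    moreover have "?p (Suc (Suc j)) \<noteq> ?p j"
      using Suc.prems k by (auto simp: petal_def)
    then have "f (?p (Suc (Suc j))) \<noteq> f (?p j)"
      using inj_onD[OF inj] V Suc.prems by (metis Suc_leI less_imp_le Suc_lessD)
    ultimately show ?case using IH by auto
  qed
  have "f (?p j) = petal k s i' j" if "j \<le> k" for j
    using step[of j] step[of "j - 1"] that k by (cases "j = k") auto
  with i'(1) show thesis using that by blast
qed

text \<open>For \<open>i = i'\<close> this reverses one petal or does nothing, depending on
  \<open>s\<close>. The centre may fall under any branch, as \<open>petal\<close> sends position 0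
  to \<open>(0, 0)\<close>.\<close>

definition petal_swap :: "nat \<Rightarrow> bool \<Rightarrow> nat \<Rightarrow> nat \<Rightarrow> nat \<times> nat \<Rightarrow> nat \<times> nat" where
  "petal_swap k s i i' p =
     (if fst p = i then petal k s i' (snd p)
      else if fst p = i' then petal k s i (snd p) else p)"

lemma petal_swap_petal:
  assumes "j \<le> k"
  shows "petal_swap k s i i' (petal k False a j) =
    (if a = i then petal k s i' j else if a = i' then petal k s i j else petal k False a j)"
  using assms by (auto simp: petal_swap_def petal_def)

text \<open>Needed for applying the swap twice: with \<open>s\<close> true the first application
  lands on reversed walks.\<close>

lemma petal_swap_petal_rev:
  assumes "j \<le> k"
  shows "petal_swap k s i i' (petal k True a j) =
    (if a = i then petal k (\<not> s) i' j else if a = i' then petal k (\<not> s) i j else petal k True a j)"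
  using assms by (auto simp: petal_swap_def petal_def)

lemma petal_swap_invol:
  "j \<le> k \<Longrightarrow> petal_swap k s i i' (petal_swap k s i i' (petal k False a j)) = petal k False a j"
  by (cases s) (simp_all add: petal_swap_petal petal_swap_petal_rev)

lemma petal_swap_image_petal_edge:
  assumes "j < k"
  shows "petal_swap k s i i' ` petal_edge k False a j =
    (if a = i then petal_edge k s i' j else if a = i' then petal_edge k s i j
     else petal_edge k False a j)"
  using assms by (auto simp: petal_edge_def petal_swap_petal)

text \<open>Applying \<open>f\<close> once more turns preservation of edges into reflection of
  edges, so one direction suffices.\<close>

lemma automorphism_if_involution:
  assumes maps: "f ` verts G \<subseteq> verts G"
    and invol: "\<And>v. v \<in> verts G \<Longrightarrow> f (f v) = v"
    and edges: "\<And>e. e \<in> edges G \<Longrightarrow> f ` e \<in> edges G"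
  shows "automorphism G f"
  unfolding automorphism_def
proof (intro conjI ballI)
  show "bij_betw f (verts G) (verts G)"
    by (rule bij_betw_byWitness[where f' = f]) (use maps invol in auto)
  fix u v
  assume "u \<in> verts G" "v \<in> verts G"
  then show "{f u, f v} \<in> edges G \<longleftrightarrow> {u, v} \<in> edges G"
    using edges[of "{f u, f v}"] edges[of "{u, v}"] invol by auto
qed

lemma automorphism_petal_swap:
  assumes "i < n" "i' < n" "k \<ge> 1"
  shows "automorphism (dutch_windmill n k) (petal_swap k s i i')"
proof (rule automorphism_if_involution)
  have n: "n \<ge> 1" using assms by simp
  show "petal_swap k s i i' ` verts (dutch_windmill n k) \<subseteq> verts (dutch_windmill n k)"
  proof (rule image_subsetI)
    fix v
    assume "v \<in> verts (dutch_windmill n k)"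
    then obtain a j where "v = petal k False a j" "a < n" "j \<le> k"
      using verts_dutch_windmill[OF n assms(3)] by auto
    then show "petal_swap k s i i' v \<in> verts (dutch_windmill n k)"
      using assms by (simp add: petal_swap_petal petal_in_verts)
  qed
  show "petal_swap k s i i' (petal_swap k s i i' v) = v" if "v \<in> verts (dutch_windmill n k)" for v
    using that verts_dutch_windmill[OF n assms(3)] petal_swap_invol by auto
  show "petal_swap k s i i' ` e \<in> edges (dutch_windmill n k)"
    if "e \<in> edges (dutch_windmill n k)" for e
  proof -
    obtain a j where "e = petal_edge k False a j" "a < n" "j < k"
      using \<open>e \<in> _\<close> by (rule edges_dutch_windmillE)
    then show ?thesis
      using assms by (simp add: petal_swap_image_petal_edge petal_edge_in_edges)
  qed
qed

section \<open>Distinguishing labelings\<close>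

definition petal_word :: "nat \<Rightarrow> ((nat \<times> nat) set \<Rightarrow> 'a) \<Rightarrow> nat \<Rightarrow> 'a list" where
  "petal_word k c i = map (\<lambda>j. c (petal_edge k False i j)) [0..<k]"

lemma length_petal_word [simp]: "length (petal_word k c i) = k"
  by (simp add: petal_word_def)

lemma nth_petal_word:
  "j < k \<Longrightarrow> (if s then rev (petal_word k c i) else petal_word k c i) ! j = c (petal_edge k s i j)"
  by (auto simp: petal_word_def rev_nth petal_edge_rev)

lemma petal_word_eq_iff:
  "petal_word k c i = (if s then rev (petal_word k c i') else petal_word k c i') \<longleftrightarrow>
    (\<forall>j<k. c (petal_edge k False i j) = c (petal_edge k s i' j))"
  using nth_petal_word[of _ k False c i] nth_petal_word[of _ k s c i']
  by (auto simp: list_eq_iff_nth_eq)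

text \<open>A coincidence of words makes a petal swap preserve the labels; conversely, a
  label-preserving automorphism maps petals to petals and so yields coincidences of words.\<close>

lemma distinguishing_labeling_dutch_windmill_iff:
  assumes n: "n \<ge> 2" and k: "k \<ge> 3"
  shows "distinguishing_labeling (dutch_windmill n k) d c \<longleftrightarrow>
    chiral_family n (petal_word k c) \<and> (\<forall>i<n. set (petal_word k c i) \<subseteq> {..<d})"
    (is "?D \<longleftrightarrow> ?C \<and> ?S")
proof -
  let ?G = "dutch_windmill n k"
  have nk: "n \<ge> 1" "k \<ge> 1" using n k by auto
  have S: "(\<forall>e\<in>edges ?G. c e < d) \<longleftrightarrow> ?S"
    by (force simp: edges_dutch_windmill petal_word_def)
  have "?C" if D: ?D
    unfolding chiral_family_def
  proof (intro allI impI)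
    fix i i' s
    assume i: "i < n" "i' < n"
      and eq: "petal_word k c i = (if s then rev (petal_word k c i') else petal_word k c i')"
    then have eq': "petal_word k c i' = (if s then rev (petal_word k c i) else petal_word k c i)"
      by (cases s) auto
    let ?f = "petal_swap k s i i'"
    have "\<forall>e\<in>edges ?G. c (?f ` e) = c e"
      using eq eq' unfolding petal_word_eq_iff
      by (auto simp: edges_dutch_windmill petal_swap_image_petal_edge)
    then have "\<forall>v\<in>verts ?G. ?f v = v"
      using D automorphism_petal_swap[OF i nk(2)] unfolding distinguishing_labeling_def by blast
    \<comment> \<open>Position 1 detects both a change of petal and a reversal, because
      \<open>1 \<noteq> k - 1\<close>.\<close>
    then have "?f (petal k False i 1) = petal k False i 1"
      using petal_in_verts[OF i(1) nk(2) nk(2)] by blast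
    then have "petal k s i' 1 = petal k False i 1"
      using nk by (simp add: petal_swap_petal)
    then show "i = i' \<and> \<not> s"
      using k by (auto simp: petal_def split: if_splits)
  qed
  moreover have "f v = v"
    if C: ?C and f: "automorphism ?G f" "\<forall>e\<in>edges ?G. c (f ` e) = c e" and v: "v \<in> verts ?G" for f v
  proof -
    obtain i j where ij: "v = petal k False i j" "i < n" "j \<le> k"
      using v verts_dutch_windmill[OF nk] by blast
    obtain i' s where i': "i' < n" and fi: "\<And>j. j \<le> k \<Longrightarrow> f (petal k False i j) = petal k s i' j"
      using automorphism_maps_petal[OF f(1) n k ij(2)] by blast
    have "c (petal_edge k False i j) = c (petal_edge k s i' j)" if "j < k" for j
    proof -
      have "f ` petal_edge k False i j = petal_edge k s i' j"
        using that by (simp add: petal_edge_def fi)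
      then show ?thesis
        using f(2) petal_edge_in_edges[OF ij(2) that, of False] by metis
    qed
    then have "i = i' \<and> \<not> s"
      by (intro chiral_familyD[OF C ij(2) i']) (simp add: petal_word_eq_iff)
    then show ?thesis using ij fi by simp
  qed
  ultimately show ?thesis
    using S unfolding distinguishing_labeling_def by blast
qed

text \<open>By \<open>petal_edge_inj\<close> an edge determines its petal and position, so the words
  can be prescribed independently.\<close>

lemma ex_petal_words:
  assumes "k \<ge> 3" "\<forall>i<n. length (w i) = k"
  obtains c where "\<And>i. i < n \<Longrightarrow> petal_word k c i = w i"
proof -
  define c where
    "c e = (case SOME (i, j). e = petal_edge k False i j \<and> j < k of (i, j) \<Rightarrow> w i ! j)" for e
  have "c (petal_edge k False i j) = w i ! j" if "j < k" for i j
  proof -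
    have "(SOME (a, b). petal_edge k False i j = petal_edge k False a b \<and> b < k) = (i, j)"
      \<comment> \<open>The choice is unique on petal edges; values of \<open>c\<close> on other
        sets are irrelevant.\<close>
      using that petal_edge_inj[OF _ assms(1) that] by (intro some_equality) auto
    then show ?thesis by (simp add: c_def)
  qed
  then have "petal_word k c i = w i" if "i < n" for i
    using that assms(2) by (intro nth_equalityI) (auto simp: petal_word_def)
  then show thesis by (rule that)
qed

lemma ex_distinguishing_labeling_dutch_windmill_iff:
  assumes n: "n \<ge> 2" and k: "k \<ge> 3"
  shows "(\<exists>c. distinguishing_labeling (dutch_windmill n k) d c) \<longleftrightarrow>
    n \<le> card (rev_minimal_words {..<d} k)"
proof -
  have "(\<exists>c. distinguishing_labeling (dutch_windmill n k) d c) \<longleftrightarrow>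
    (\<exists>w. chiral_family n w \<and> (\<forall>i<n. set (w i) \<subseteq> {..<d} \<and> length (w i) = k))"
    unfolding distinguishing_labeling_dutch_windmill_iff[OF n k]
  proof
    assume "\<exists>w. chiral_family n w \<and> (\<forall>i<n. set (w i) \<subseteq> {..<d} \<and> length (w i) = k)"
    then obtain w where w: "chiral_family n w" "\<forall>i<n. set (w i) \<subseteq> {..<d} \<and> length (w i) = k"
      by blast
    then obtain c where c: "\<And>i. i < n \<Longrightarrow> petal_word k c i = w i"
      using ex_petal_words[OF k, of n w] by blast
    have "chiral_family n (petal_word k c)"
      unfolding chiral_family_def
      by (intro allI impI, rule chiral_familyD[OF w(1)]) (simp_all add: c)
    moreover have "\<forall>i<n. set (petal_word k c i) \<subseteq> {..<d}"
      using w(2) c by simp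
    ultimately show "\<exists>c. chiral_family n (petal_word k c)
        \<and> (\<forall>i<n. set (petal_word k c i) \<subseteq> {..<d})"
      by blast
  next
    assume "\<exists>c. chiral_family n (petal_word k c) \<and> (\<forall>i<n. set (petal_word k c i) \<subseteq> {..<d})"
    then show "\<exists>w. chiral_family n w \<and> (\<forall>i<n. set (w i) \<subseteq> {..<d} \<and> length (w i) = k)"
      using length_petal_word by blast
  qed
  then show ?thesis by (simp add: ex_chiral_family_iff)
qed

theorem theorem2p2:
  fixes n k :: nat
  assumes "n \<ge> 2" and "k \<ge> 3"
  shows "distinguishing_index (dutch_windmill n k) =
    (LEAST r::nat. (real r ^ k - real r ^ nat \<lceil>real k / 2\<rceil>) / 2 \<ge> real n)"
proof -
  have "nat \<lceil>real k / 2\<rceil> = (k + 1) div 2"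
    by linarith
  moreover have "2 * real (card (rev_minimal_words {..<r} k)) + real r ^ ((k + 1) div 2) = real r ^ k"
    for r :: nat
    using arg_cong[OF card_rev_minimal_words[of "{..<r}" k], where f = real] by simp
  \<comment> \<open>The quotient is exactly the number of classes, so both \<open>LEAST\<close>
    operators range over the same predicate.\<close>
  ultimately have "(real r ^ k - real r ^ nat \<lceil>real k / 2\<rceil>) / 2 = card (rev_minimal_words {..<r} k)"
    for r :: nat
    by (simp add: field_simps flip: eq_diff_eq)
  then show ?thesis
    using assms by (simp add: distinguishing_index_def ex_distinguishing_labeling_dutch_windmill_iff)
qed

end
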